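(* The Hamiltonian system on $T^*(SE(3))$ $$\dot\gamma=\lambda_3\mathcal A_3|_\gamma+\lambda_4\mathcal A_4|_\gamma+\lambda_5\mathcal A_5|_\gamma,$$ $$\dot\lambda_1=-\lambda_3\lambda_5,\quad \dot\lambda_2=\lambda_3\lambda_4,\quad \dot\lambda_3=\lambda_1\lambda_5-\lambda_2\lambda_4,\quad \dot\lambda_4=\lambda_2\lambda_3-\lambda_5\lambda_6,\quad \dot\lambda_5=\lambda_4\lambda_6-\lambda_1\lambda_3,\quad \dot\lambda_6=0$$ with Hamiltonian $H=\frac12(\lambda_3^2+\lambda_4^2+\lambda_5^2)$ is Liouville integrable. Functionally independent first integrals are $\rho_1,\rho_2,\rho_3$, $W=-\lambda_1\lambda_4-\lambda_2\lambda_5-\lambda_3\lambda_6$, $H=\frac12(\lambda_3^2+\lambda_4^2+\lambda_5^2)$ and $\lambda_6$, where $$\begin{aligned}\rho_1&=-\lambda_1\cos\alpha\cos\beta+\lambda_2\cos\beta\sin\alpha-\lambda_3\sin\beta,\\ \rho_2&=-\cos\gamma(\lambda_2\cos\alpha+\lambda_1\sin\alpha)+(\lambda_3\cos\beta+(-\lambda_1\cos\alpha+\lambda_2\sin\alpha)\sin\beta)\sin\gamma,\\ \rho_3&=-\lambda_3\cos\beta\cos\gamma+\cos\gamma(\lambda_1\cos\alpha-\lambda_2\sin\alpha)\sin\beta-(\lambda_2\cos\alpha+\lambda_1\sin\alpha)\sin\gamma.\end{aligned}$$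
   Context: $SE(3)=\mathbb R^3\rtimes SO(3)$ with product $(\mathbf x_1,R_1)(\mathbf x_2,R_2)=(\mathbf x_1+R_1\mathbf x_2,R_1R_2)$. For $\mathbf a\in\mathbb R^3$ let $\sigma_{\mathbf a}\mathbf y=\mathbf a\times\mathbf y$. The left-invariant frame is $\mathcal A_i|_{(\mathbf x,R)}=(R\mathbf e_i,0)$, $\mathcal A_{3+i}|_{(\mathbf x,R)}=(0,R\sigma_{\mathbf e_i})$, $i=1,2,3$. Momentum coordinates are the left-invariant Hamiltonians $\lambda_i(q,\lambda)=\langle\lambda,\mathcal A_i|_q\rangle$ for $\lambda\in T_q^*(SE(3))$, with Poisson brackets $\{\lambda_i,\lambda_j\}=\sum_kc_{i,j}^k\lambda_k$, where $[\mathcal A_i,\mathcal A_j]=\sum_kc^k_{i,j}\mathcal A_k$. The system is the Hamiltonian system of the Pontryagin Maximum Principle for the sub-Riemannian problem on $SE(3)$ with distribution $\mathrm{span}\{\mathcal A_3,\mathcal A_4,\mathcal A_5\}$ and $\mathcal A_3,\mathcal A_4,\mathcal A_5$ orthonormal. The angles $\alpha,\beta,\gamma$ in the formulas for $\rho_i$ (not to be confused with the curve $\gamma$) parametrize $R=R_{\mathbf e_x,\gamma}R_{\mathbf e_y,\beta}R_{\mathbf e_z,\alpha}$ (counterclockwise rotations about the coordinate axes). Equivalently $(\rho_1,\rho_2,\rho_3)^T=-R(\lambda_1,\lambda_2,\lambda_3)^T$; the $\rho_i$ are the Hamiltonians of the right-invariant vector fields $-\partial_x,-\partial_y,-\partial_z$.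 Liouville integrable means: there exist six first integrals that are pairwise in involution with respect to the Poisson bracket and functionally independent on an open dense subset of $T^*(SE(3))$. *)

theory Defs
  imports "HOL-Analysis.Analysis"
begin

section \<open>Vectors with six components\<close>

lemma exhaust_6:
  fixes x :: 6
  shows "x = 1 \<or> x = 2 \<or> x = 3 \<or> x = 4 \<or> x = 5 \<or> x = 6"
proof (induct x)
  case (of_int z)
  then have "z = 0 \<or> z = 1 \<or> z = 2 \<or> z = 3 \<or> z = 4 \<or> z = 5" by fastforce
  then show ?case by auto
qed

lemma forall_6: "(\<forall>i::6. P i) \<longleftrightarrow> P 1 \<and> P 2 \<and> P 3 \<and> P 4 \<and> P 5 \<and> P 6"
  by (metis exhaust_6)

lemma UNIV_6: "UNIV = {1, 2, 3, 4, 5, 6 :: 6}"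
  using exhaust_6 by auto

lemma sum_6: "sum f (UNIV :: 6 set) = f 1 + f 2 + f 3 + f 4 + f 5 + f 6"
  unfolding UNIV_6 by (simp add: ac_simps)

lemma vector_6:
  "(vector [a, b, c, d, e, f] :: ('a::zero)^6) $ 1 = a"
  "(vector [a, b, c, d, e, f] :: ('a::zero)^6) $ 2 = b"
  "(vector [a, b, c, d, e, f] :: ('a::zero)^6) $ 3 = c"
  "(vector [a, b, c, d, e, f] :: ('a::zero)^6) $ 4 = d"
  "(vector [a, b, c, d, e, f] :: ('a::zero)^6) $ 5 = e"
  "(vector [a, b, c, d, e, f] :: ('a::zero)^6) $ 6 = f"
  unfolding vector_def by simp_all

section \<open>The group \<open>SE(3)\<close> and its left-invariant frame\<close>

type_synonym config = "(real^3) \<times> (real^3^3)"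

definition SE3 :: "config set" where
  "SE3 = {(x, R). rotation_matrix R}"

definition se3_mult :: "config \<Rightarrow> config \<Rightarrow> config" where
  "se3_mult g h = (fst g + snd g *v fst h, snd g ** snd h)"

definition sigma :: "real^3 \<Rightarrow> real^3^3" where
  "sigma a = matrix (\<lambda>y. cross3 a y)"

text \<open>The fields are given by formulas on all of the ambient vector space \<^typ>\<open>config\<close>,
  in which \<^const>\<open>SE3\<close> is an embedded submanifold; on \<^const>\<open>SE3\<close> they are tangent to it.\<close>

definition frame :: "6 \<Rightarrow> config \<Rightarrow> config" where
  "frame i q =
     (vector [(snd q *v axis 1 1, 0), (snd q *v axis 2 1, 0), (snd q *v axis 3 1, 0),
              (0, snd q ** sigma (axis 1 1)), (0, snd q ** sigma (axis 2 1)),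
              (0, snd q ** sigma (axis 3 1))] :: config^6) $ i"

definition lie_bracket :: "(config \<Rightarrow> config) \<Rightarrow> (config \<Rightarrow> config) \<Rightarrow> config \<Rightarrow> config" where
  "lie_bracket X Y q = frechet_derivative Y (at q) (X q) - frechet_derivative X (at q) (Y q)"

definition struct_const :: "6 \<Rightarrow> 6 \<Rightarrow> 6 \<Rightarrow> real" where
  "struct_const i j k =
     (THE c :: real^6. \<forall>q\<in>SE3. lie_bracket (frame i) (frame j) q = (\<Sum>m\<in>UNIV. c $ m *\<^sub>R frame m q)) $ k"

lemma frame_simps:
  "frame 1 q = (snd q *v axis 1 1, 0)"
  "frame 2 q = (snd q *v axis 2 1, 0)"
  "frame 3 q = (snd q *v axis 3 1, 0)"
  "frame 4 q = (0, snd q ** sigma (axis 1 1))"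
  "frame 5 q = (0, snd q ** sigma (axis 2 1))"
  "frame 6 q = (0, snd q ** sigma (axis 3 1))"
  by (simp_all add: frame_def vector_6)

lemma linear_frame: "linear (frame i)"
  using exhaust_6[of i]
  by (auto simp: frame_simps linear_iff prod_eq_iff vec_eq_iff matrix_vector_mult_def
      matrix_matrix_mult_def sum.distrib sum_distrib_left algebra_simps)

lemma has_derivative_se3_mult:
  "(se3_mult g has_derivative (\<lambda>v. (snd g *v fst v, snd g ** snd v))) (at q)"
proof -
  have "linear (\<lambda>v. (snd g *v fst v, snd g ** snd v) :: config)"
    by (auto simp: linear_iff prod_eq_iff vec_eq_iff matrix_vector_mult_def
        matrix_matrix_mult_def sum.distrib sum_distrib_left algebra_simps)
  then have "((\<lambda>v. (snd g *v fst v, snd g ** snd v)) has_derivative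
      (\<lambda>v. (snd g *v fst v, snd g ** snd v) :: config)) (at q)"
    by (simp only: bounded_linear_imp_has_derivative linear_conv_bounded_linear)
  from has_derivative_add[OF has_derivative_const[of "(fst g, 0)"] this]
  have "((\<lambda>v. (fst g, 0) + (snd g *v fst v, snd g ** snd v)) has_derivative
      (\<lambda>v. (snd g *v fst v, snd g ** snd v) :: config)) (at q)"
    by simp
  moreover have "se3_mult g = (\<lambda>v. (fst g, 0) + (snd g *v fst v, snd g ** snd v))"
    by (auto simp: se3_mult_def)
  ultimately show ?thesis by simp
qed

lemma frame_left_invariant:
  "frechet_derivative (se3_mult g) (at q) (frame i q) = frame i (se3_mult g q)"
proof -
  have "frechet_derivative (se3_mult g) (at q) = (\<lambda>v. (snd g *v fst v, snd g ** snd v))"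
    by (rule frechet_derivative_at[OF has_derivative_se3_mult, symmetric])
  then show ?thesis
    using exhaust_6[of i]
    by (auto simp: frame_simps se3_mult_def matrix_vector_mul_assoc matrix_mul_assoc)
qed

text \<open>The following facts show that the description in \<open>struct_const_def\<close> is proper.\<close>

lemma lie_bracket_frame_eq:
  "lie_bracket (frame i) (frame j) q = frame j (frame i q) - frame i (frame j q)"
proof -
  have "frechet_derivative (frame k) (at q) = frame k" for k
    by (metis bounded_linear_imp_has_derivative frechet_derivative_at linear_conv_bounded_linear linear_frame)
  then show ?thesis by (simp add: lie_bracket_def)
qed

lemma frame_independent:
  fixes c d :: "real^6"
  assumes "q \<in> SE3" "(\<Sum>m\<in>UNIV. c $ m *\<^sub>R frame m q) = (\<Sum>m\<in>UNIV. d $ m *\<^sub>R frame m q)"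
  shows "c = d"
proof -
  obtain x R where q: "q = (x, R)" by (cases q)
  have inv: "transpose R ** R = mat 1"
    using assms(1) by (simp add: SE3_def q rotation_matrix_def orthogonal_matrix_def)
  have left: "transpose R *v (R *v u) = u" for u
    by (simp add: matrix_vector_mul_assoc inv)
  have left': "transpose R ** (R ** M) = M" for M :: "real^3^3"
    by (simp add: matrix_mul_assoc inv)
  let ?a = "\<lambda>c::real^6. vector [c$1, c$2, c$3] :: real^3"
  let ?w = "\<lambda>c::real^6. vector [c$4, c$5, c$6] :: real^3"
  have eq: "(\<Sum>m\<in>UNIV. c $ m *\<^sub>R frame m q) = (R *v ?a c, R ** sigma (?w c))" for c :: "real^6"
    by (simp add: q sum_6 frame_simps matrix_vector_mult_def matrix_matrix_mult_def
        sigma_def matrix_def cross3_def axis_def vec_eq_iff forall_3 sum_3 algebra_simps)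
  from assms(2)[unfolded eq] have "R *v ?a c = R *v ?a d" "R ** sigma (?w c) = R ** sigma (?w d)"
    unfolding prod.inject by blast+
  then have "?a c = ?a d" and w: "sigma (?w c) = sigma (?w d)"
    by (metis left, metis left')
  have "sigma u $ 3 $ 2 = u $ 1" "sigma u $ 1 $ 3 = u $ 2" "sigma u $ 2 $ 1 = u $ 3" for u
    by (simp_all add: sigma_def matrix_def cross3_def axis_def)
  then have "?w c = ?w d"
    unfolding vec_eq_iff forall_3 using w by metis
  then have vector_eq: "?w c $ k = ?w d $ k" "?a c $ k = ?a d $ k" for k
    using \<open>?a c = ?a d\<close> by simp_all
  show ?thesis
    unfolding vec_eq_iff forall_6
    using vector_eq(1)[of 1] vector_eq(1)[of 2] vector_eq(1)[of 3]
      vector_eq(2)[of 1] vector_eq(2)[of 2] vector_eq(2)[of 3]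
    unfolding vector_3 by blast
qed

lemma lie_bracket_frame_exists:
  "\<exists>c::real^6. \<forall>q. lie_bracket (frame i) (frame j) q = (\<Sum>m\<in>UNIV. c $ m *\<^sub>R frame m q)"
proof -
  let ?a = "\<lambda>c::real^6. vector [c$1, c$2, c$3] :: real^3"
  let ?w = "\<lambda>c::real^6. vector [c$4, c$5, c$6] :: real^3"
  let ?u = "cross3 (?w (axis i 1)) (?a (axis j 1)) - cross3 (?w (axis j 1)) (?a (axis i 1))"
  let ?v = "cross3 (?w (axis i 1)) (?w (axis j 1))"
  have "\<forall>q. lie_bracket (frame i) (frame j) q
      = (\<Sum>m\<in>UNIV. (vector [?u$1, ?u$2, ?u$3, ?v$1, ?v$2, ?v$3] :: real^6) $ m *\<^sub>R frame m q)"
    using exhaust_6[of i] exhaust_6[of j]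
    by (elim disjE; simp add: lie_bracket_frame_eq sum_6 vector_6 frame_simps cross3_def axis_def
        sigma_def matrix_def matrix_vector_mult_def matrix_matrix_mult_def
        prod_eq_iff vec_eq_iff forall_3 sum_3)
  then show ?thesis by blast
qed

lemma lie_bracket_frame:
  assumes "q \<in> SE3"
  shows "lie_bracket (frame i) (frame j) q = (\<Sum>k\<in>UNIV. struct_const i j k *\<^sub>R frame k q)"
proof -
  have "\<exists>!c::real^6. \<forall>q\<in>SE3. lie_bracket (frame i) (frame j) q = (\<Sum>m\<in>UNIV. c $ m *\<^sub>R frame m q)"
  proof (rule ex_ex1I)
    show "\<exists>c::real^6. \<forall>q\<in>SE3. lie_bracket (frame i) (frame j) q = (\<Sum>m\<in>UNIV. c $ m *\<^sub>R frame m q)"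
      using lie_bracket_frame_exists[of i j] by blast
    show "c = d" if "\<forall>q\<in>SE3. lie_bracket (frame i) (frame j) q = (\<Sum>m\<in>UNIV. c $ m *\<^sub>R frame m q)"
      "\<forall>q\<in>SE3. lie_bracket (frame i) (frame j) q = (\<Sum>m\<in>UNIV. d $ m *\<^sub>R frame m q)" for c d :: "real^6"
      using frame_independent[OF assms trans[OF that(1)[rule_format, OF assms, symmetric] that(2)[rule_format, OF assms]]] .
  qed
  from theI'[OF this] assms show ?thesis
    unfolding struct_const_def by (rule bspec)
qed


section \<open>The cotangent bundle and its Poisson structure\<close>

text \<open>The bundle is trivialised by the frame: \<open>(q, l)\<close> stands for the covector at \<open>q\<close>
  whose value on \<open>frame i q\<close> is \<open>l $ i\<close>, so that the left-invariant Hamiltonian of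
  \<open>frame i\<close> is the coordinate function \<open>lam i\<close>.\<close>

type_synonym phase = "config \<times> (real^6)"

definition cotangent_SE3 :: "phase set" where
  "cotangent_SE3 = SE3 \<times> UNIV"

definition tangent_phase :: "phase \<Rightarrow> phase set" where
  "tangent_phase p = span (range (\<lambda>i. frame i (fst p))) \<times> UNIV"

definition lam :: "6 \<Rightarrow> phase \<Rightarrow> real" where
  "lam i p = snd p $ i"

primrec times_differentiable :: "nat \<Rightarrow> ('a::euclidean_space \<Rightarrow> real) \<Rightarrow> bool" where
  "times_differentiable 0 f \<longleftrightarrow> continuous_on UNIV f"
| "times_differentiable (Suc n) f \<longleftrightarrow>
     (\<forall>x. f differentiable (at x)) \<and>
     (\<forall>v. times_differentiable n (\<lambda>x. frechet_derivative f (at x) v))"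

text \<open>Since \<^const>\<open>cotangent_SE3\<close> is a closed embedded submanifold of \<^typ>\<open>phase\<close>, its smooth
  functions are exactly the restrictions of smooth functions on \<^typ>\<open>phase\<close>.\<close>

definition smooth :: "('a::euclidean_space \<Rightarrow> real) \<Rightarrow> bool" where
  "smooth f \<longleftrightarrow> (\<forall>n. times_differentiable n f)"

definition horizontal_deriv :: "6 \<Rightarrow> (phase \<Rightarrow> real) \<Rightarrow> phase \<Rightarrow> real" where
  "horizontal_deriv i F p = frechet_derivative F (at p) (frame i (fst p), 0)"

definition vertical_deriv :: "6 \<Rightarrow> (phase \<Rightarrow> real) \<Rightarrow> phase \<Rightarrow> real" where
  "vertical_deriv i F p = frechet_derivative F (at p) (0, axis i 1)"

text \<open>The canonical bracket in the left trivialisation: the biderivation for which functions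
  on \<^const>\<open>SE3\<close> commute, \<open>{lam i, f}\<close> is the derivative of \<open>f\<close> along \<open>frame i\<close>, and
  \<open>{lam i, lam j}\<close> is the sum of \<open>struct_const i j k * lam k\<close> over \<open>k\<close>.  Only derivatives
  tangent to \<^const>\<open>cotangent_SE3\<close> occur, so on it the bracket does not depend on how the
  functions are extended to the ambient space.\<close>

definition poisson :: "(phase \<Rightarrow> real) \<Rightarrow> (phase \<Rightarrow> real) \<Rightarrow> phase \<Rightarrow> real" where
  "poisson F G p =
     (\<Sum>i\<in>UNIV. vertical_deriv i F p * horizontal_deriv i G p
             - horizontal_deriv i F p * vertical_deriv i G p)
     + (\<Sum>i\<in>UNIV. \<Sum>j\<in>UNIV. \<Sum>k\<in>UNIV.
          struct_const i j k * lam k p * vertical_deriv i F p * vertical_deriv j G p)"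

lemma frechet_derivative_lam: "frechet_derivative (lam i) (at p) = lam i"
proof -
  have "linear (lam i)" by (simp add: lam_def linear_iff)
  then show ?thesis
    by (metis bounded_linear_imp_has_derivative frechet_derivative_at linear_conv_bounded_linear)
qed

lemma poisson_lam: "poisson (lam i) (lam j) p = (\<Sum>k\<in>UNIV. struct_const i j k * lam k p)"
proof -
  have v: "vertical_deriv k (lam m) p = (if k = m then 1 else 0)" for k m
    by (simp add: vertical_deriv_def frechet_derivative_lam lam_def axis_def)
  have h: "horizontal_deriv k (lam m) p = 0" for k m
    by (simp add: horizontal_deriv_def frechet_derivative_lam lam_def)
  have "(\<Sum>k\<in>UNIV. struct_const a b k * lam k p * (if a = i then 1 else 0) * (if b = j then 1 else 0))
      = (if b = j then if a = i then (\<Sum>k\<in>UNIV. struct_const a b k * lam k p) else 0 else 0)" for a b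
    by simp
  then have "poisson (lam i) (lam j) p = (\<Sum>a\<in>UNIV. \<Sum>b\<in>UNIV.
      if b = j then if a = i then (\<Sum>k\<in>UNIV. struct_const a b k * lam k p) else 0 else 0)"
    unfolding poisson_def v h by simp
  also have "\<dots> = (\<Sum>k\<in>UNIV. struct_const i j k * lam k p)"
    by simp
  finally show ?thesis .
qed

text \<open>Sign convention: the time derivative of an observable \<open>F\<close> is \<open>{H, F}\<close>.\<close>

definition hamiltonian_field :: "(phase \<Rightarrow> real) \<Rightarrow> (phase \<Rightarrow> phase) \<Rightarrow> bool" where
  "hamiltonian_field H X \<longleftrightarrow>
     (\<forall>p\<in>cotangent_SE3. X p \<in> tangent_phase p \<and>
        (\<forall>F. smooth F \<longrightarrow> frechet_derivative F (at p) (X p) = poisson H F p))"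

section \<open>Integrability\<close>

definition solution :: "(phase \<Rightarrow> phase) \<Rightarrow> real set \<Rightarrow> (real \<Rightarrow> phase) \<Rightarrow> bool" where
  "solution X I z \<longleftrightarrow> is_interval I \<and>
     (\<forall>t\<in>I. z t \<in> cotangent_SE3 \<and> (z has_vector_derivative X (z t)) (at t within I))"

definition first_integral :: "(phase \<Rightarrow> phase) \<Rightarrow> (phase \<Rightarrow> real) \<Rightarrow> bool" where
  "first_integral X F \<longleftrightarrow> smooth F \<and>
     (\<forall>I z. solution X I z \<longrightarrow> (\<forall>s\<in>I. \<forall>t\<in>I. F (z s) = F (z t)))"

definition in_involution :: "(6 \<Rightarrow> phase \<Rightarrow> real) \<Rightarrow> bool" where
  "in_involution F \<longleftrightarrow> (\<forall>i j. \<forall>p\<in>cotangent_SE3. poisson (F i) (F j) p = 0)"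

definition functionally_independent_at :: "(6 \<Rightarrow> phase \<Rightarrow> real) \<Rightarrow> phase \<Rightarrow> bool" where
  "functionally_independent_at F p \<longleftrightarrow>
     (\<forall>c :: 6 \<Rightarrow> real.
        (\<forall>v\<in>tangent_phase p. (\<Sum>i\<in>UNIV. c i * frechet_derivative (F i) (at p) v) = 0)
        \<longrightarrow> (\<forall>i. c i = 0))"

definition functionally_independent :: "(6 \<Rightarrow> phase \<Rightarrow> real) \<Rightarrow> bool" where
  "functionally_independent F \<longleftrightarrow>
     (\<exists>U. openin (top_of_set cotangent_SE3) U \<and> cotangent_SE3 \<subseteq> closure U \<and>
          (\<forall>p\<in>U. functionally_independent_at F p))"

definition liouville_integrable :: "(phase \<Rightarrow> phase) \<Rightarrow> bool" where
  "liouville_integrable X \<longleftrightarrow>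
     (\<exists>F :: 6 \<Rightarrow> phase \<Rightarrow> real.
        (\<forall>i. first_integral X (F i)) \<and> in_involution F \<and> functionally_independent F)"

section \<open>The system and its integrals\<close>

definition system_field :: "phase \<Rightarrow> phase" where
  "system_field p =
     (lam 3 p *\<^sub>R frame 3 (fst p) + lam 4 p *\<^sub>R frame 4 (fst p) + lam 5 p *\<^sub>R frame 5 (fst p),
      vector [- lam 3 p * lam 5 p,
              lam 3 p * lam 4 p,
              lam 1 p * lam 5 p - lam 2 p * lam 4 p,
              lam 2 p * lam 3 p - lam 5 p * lam 6 p,
              lam 4 p * lam 6 p - lam 1 p * lam 3 p,
              0])"

definition Ham :: "phase \<Rightarrow> real" where
  "Ham p = (1/2) * ((lam 3 p)\<^sup>2 + (lam 4 p)\<^sup>2 + (lam 5 p)\<^sup>2)"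

definition Wint :: "phase \<Rightarrow> real" where
  "Wint p = - lam 1 p * lam 4 p - lam 2 p * lam 5 p - lam 3 p * lam 6 p"

text \<open>The coordinate-free form \<open>- R (lam 1, lam 2, lam 3)\<close>, defined for every rotation \<open>R\<close>
  without choosing angles: \<open>rho i\<close> is the Hamiltonian of the right-invariant field \<open>(- e\<^sub>i, 0)\<close>.\<close>

definition rho :: "3 \<Rightarrow> phase \<Rightarrow> real" where
  "rho i p = - (snd (fst p) *v vector [lam 1 p, lam 2 p, lam 3 p]) $ i"

definition integrals :: "6 \<Rightarrow> phase \<Rightarrow> real" where
  "integrals i p = (vector [rho 1 p, rho 2 p, rho 3 p, Wint p, Ham p, lam 6 p] :: real^6) $ i"

definition rot_x :: "real \<Rightarrow> real^3^3" where
  "rot_x t = vector [vector [1, 0, 0], vector [0, cos t, - sin t], vector [0, sin t, cos t]]"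

definition rot_y :: "real \<Rightarrow> real^3^3" where
  "rot_y t = vector [vector [cos t, 0, sin t], vector [0, 1, 0], vector [- sin t, 0, cos t]]"

definition rot_z :: "real \<Rightarrow> real^3^3" where
  "rot_z t = vector [vector [cos t, - sin t, 0], vector [sin t, cos t, 0], vector [0, 0, 1]]"

end

theory Submission
  imports Defs
begin

text \<open>The functions \<open>rho i\<close> generate left translations, so they Poisson-commute with every function
  of the left-invariant momenta and, translations being commutative, with each other; \<open>Wint\<close> is a
  Casimir function of the Lie-Poisson bracket of \<open>se(3)\<close>; and \<open>{Ham, lam 6} = 0\<close> is a direct
  computation.  Commuting with \<open>Ham\<close> gives constancy along solutions.  For independence the
  derivatives in the momentum directions suffice: where \<open>lam 1 * lam 5 \<noteq> lam 2 * lam 4\<close>, the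
  directions \<open>4, 5, 6\<close> eliminate \<open>Wint\<close>, \<open>Ham\<close> and \<open>lam 6\<close>, and then the directions \<open>1, 2, 3\<close>
  eliminate the \<open>rho i\<close> because the rotation matrix is invertible.\<close>

section \<open>Smooth functions\<close>

text \<open>The product rule brings back the undifferentiated factors, so the induction for products
  needs differentiability one order lower as well.\<close>

lemma times_differentiable_SucD:
  "times_differentiable (Suc n) f \<Longrightarrow> times_differentiable n f"
proof (induction n arbitrary: f)
  case 0
  then show ?case
    by (auto intro!: differentiable_imp_continuous_on
        simp: differentiable_on_def differentiable_at_withinI)
next
  case (Suc n)
  then show ?case by auto
qed

lemma times_differentiable_const: "times_differentiable n (\<lambda>x. c)"
  by (induction n arbitrary: c) (auto simp: frechet_derivative_const)

lemma times_differentiable_linear: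
  assumes "bounded_linear f"
  shows "times_differentiable n f"
proof (cases n)
  case 0
  then show ?thesis using assms by (simp add: linear_continuous_on)
next
  case (Suc m)
  have "frechet_derivative f (at x) = f" for x
    using frechet_derivative_at[OF bounded_linear_imp_has_derivative[OF assms]] by metis
  then show ?thesis
    using Suc assms by (auto simp: times_differentiable_const bounded_linear_imp_differentiable)
qed

lemma times_differentiable_add:
  "times_differentiable n f \<Longrightarrow> times_differentiable n g \<Longrightarrow> times_differentiable n (\<lambda>x. f x + g x)"
proof (induction n arbitrary: f g)
  case 0
  then show ?case by (auto intro: continuous_intros)
next
  case (Suc n)
  have "frechet_derivative (\<lambda>x. f x + g x) (at x)
      = (\<lambda>v. frechet_derivative f (at x) v + frechet_derivative g (at x) v)" for x
    using Suc.prems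
    by (intro frechet_derivative_at[symmetric] has_derivative_add)
       (auto simp: frechet_derivative_works)
  then show ?case using Suc by simp
qed

lemma times_differentiable_mult:
  "times_differentiable n f \<Longrightarrow> times_differentiable n g \<Longrightarrow> times_differentiable n (\<lambda>x. f x * g x)"
proof (induction n arbitrary: f g)
  case 0
  then show ?case by (auto intro: continuous_intros)
next
  case (Suc n)
  have "frechet_derivative (\<lambda>x. f x * g x) (at x)
      = (\<lambda>v. f x * frechet_derivative g (at x) v + frechet_derivative f (at x) v * g x)" for x
    using Suc.prems
    by (intro frechet_derivative_at[symmetric] has_derivative_mult)
       (auto simp: frechet_derivative_works)
  moreover have "times_differentiable n f" "times_differentiable n g"
    using Suc.prems by (blast intro: times_differentiable_SucD)+
  ultimately show ?case
    using Suc by (auto intro!: times_differentiable_add)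
qed

lemma smooth_const: "smooth (\<lambda>x. c)"
  by (simp add: smooth_def times_differentiable_const)

lemma smooth_linear: "bounded_linear f \<Longrightarrow> smooth f"
  by (simp add: smooth_def times_differentiable_linear)

lemma smooth_add: "smooth f \<Longrightarrow> smooth g \<Longrightarrow> smooth (\<lambda>x. f x + g x)"
  by (simp add: smooth_def times_differentiable_add)

lemma smooth_mult: "smooth f \<Longrightarrow> smooth g \<Longrightarrow> smooth (\<lambda>x. f x * g x)"
  by (simp add: smooth_def times_differentiable_mult)

lemma smooth_uminus: "smooth f \<Longrightarrow> smooth (\<lambda>x. - f x)"
  using smooth_mult[OF smooth_const[of "-1"]] by simp

lemma smooth_diff: "smooth f \<Longrightarrow> smooth g \<Longrightarrow> smooth (\<lambda>x. f x - g x)"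
  using smooth_add[OF _ smooth_uminus] by simp

lemma smooth_power2: "smooth f \<Longrightarrow> smooth (\<lambda>x. (f x)\<^sup>2)"
  by (simp add: power2_eq_square smooth_mult)

lemma smooth_has_derivative:
  "smooth f \<Longrightarrow> (f has_derivative frechet_derivative f (at x)) (at x)"
  using times_differentiable.simps(2)[of 0 f]
  unfolding smooth_def frechet_derivative_works by blast

section \<open>Structure constants and the bracket\<close>

text \<open>This is the Lie algebra se(3): with \<open>a\<close> and \<open>w\<close> the
  translational and rotational parts of a basis vector, the bracket of (a, w) and (a', w') is (w x
  a' - w' x a, w x w').\<close>

lemma struct_const_eq:
  fixes i j :: 6
  defines "a \<equiv> \<lambda>i. vector [axis i 1 $ 1, axis i 1 $ 2, axis i 1 $ 3] :: real^3"
    and "w \<equiv> \<lambda>i. vector [axis i 1 $ 4, axis i 1 $ 5, axis i 1 $ 6] :: real^3"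
  defines "u \<equiv> cross3 (w i) (a j) - cross3 (w j) (a i)"
    and "v \<equiv> cross3 (w i) (w j)"
  shows "struct_const i j k = (vector [u$1, u$2, u$3, v$1, v$2, v$3] :: real^6) $ k"
proof -
  \<comment> \<open>The structure constants are the same at every point and the frame is independent
    at each, so evaluation at the group identity determines them.\<close>
  let ?q = "(0, mat 1) :: config"
  have q: "?q \<in> SE3"
    by (simp add: SE3_def rotation_matrix_def orthogonal_matrix_def)
  have "lie_bracket (frame i) (frame j) ?q
      = (\<Sum>m\<in>UNIV. (vector [u$1, u$2, u$3, v$1, v$2, v$3] :: real^6) $ m *\<^sub>R frame m ?q)"
    using exhaust_6[of i] exhaust_6[of j] unfolding u_def v_def a_def w_def
    by (elim disjE; simp add: lie_bracket_frame_eq sum_6 vector_6 frame_simps cross3_def axis_def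
        sigma_def matrix_def matrix_vector_mult_def matrix_matrix_mult_def
        prod_eq_iff vec_eq_iff forall_3 sum_3)
  then have "(\<chi> m. struct_const i j m) = (vector [u$1, u$2, u$3, v$1, v$2, v$3] :: real^6)"
    using lie_bracket_frame[OF q, of i j] by (intro frame_independent[OF q]) simp
  then show ?thesis
    by (metis vec_lambda_beta)
qed

text \<open>With the structure constants inserted, the Lie-Poisson part becomes two groups of triple
  products: (\<open>lam 1\<close>, \<open>lam 2\<close>, \<open>lam 3\<close>) against the
  translational part of the se(3) bracket of \<open>u\<close> and \<open>w\<close>, and
  (\<open>lam 4\<close>, \<open>lam 5\<close>, \<open>lam 6\<close>) against its rotational
  part.\<close>

lemma poisson_eq:
  fixes F G :: "phase \<Rightarrow> real" and p :: phase
  defines "u \<equiv> \<lambda>i. vertical_deriv i F p" and "w \<equiv> \<lambda>i. vertical_deriv i G p"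
  shows "poisson F G p =
     (\<Sum>i\<in>UNIV. u i * horizontal_deriv i G p - horizontal_deriv i F p * w i)
     + lam 1 p * (u 5 * w 3 - u 6 * w 2 - (w 5 * u 3 - w 6 * u 2))
     + lam 2 p * (u 6 * w 1 - u 4 * w 3 - (w 6 * u 1 - w 4 * u 3))
     + lam 3 p * (u 4 * w 2 - u 5 * w 1 - (w 4 * u 2 - w 5 * u 1))
     + lam 4 p * (u 5 * w 6 - u 6 * w 5)
     + lam 5 p * (u 6 * w 4 - u 4 * w 6)
     + lam 6 p * (u 4 * w 5 - u 5 * w 4)"
proof -
  \<comment> \<open>\<open>\<Delta> i j k m n\<close> is the contribution of a structure constant 1
    located at (m, n) with output index k. Below, the 18 nonzero structure constants appear as 18
    signed terms of this kind.\<close>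
  define \<Delta> where "\<Delta> i j k m n = lam k p * (axis i 1 $ m * axis j 1 $ n) * u i * w j" for i j k m n
  have "(\<Sum>j\<in>UNIV. \<Delta> i j k m n) = lam k p * axis i 1 $ m * u i * w n" for i k m n
    by (simp add: \<Delta>_def axis_def if_distrib[of "\<lambda>x. _ * x"] if_distrib[of "\<lambda>x. x * _"]
        cong: if_cong)
  then have \<Delta>_sum: "(\<Sum>i\<in>UNIV. \<Sum>j\<in>UNIV. \<Delta> i j k m n) = lam k p * (u m * w n)" for k m n
    by (simp add: axis_def if_distrib[of "\<lambda>x. _ * x"] if_distrib[of "\<lambda>x. x * _"]
        cong: if_cong)
  have "(\<Sum>k\<in>UNIV. struct_const i j k * lam k p * u i * w j) =
      \<Delta> i j 1 5 3 - \<Delta> i j 1 6 2 - \<Delta> i j 1 3 5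
      + \<Delta> i j 1 2 6 + \<Delta> i j 2 6 1 - \<Delta> i j 2 4 3
      - \<Delta> i j 2 1 6 + \<Delta> i j 2 3 4 + \<Delta> i j 3 4 2
      - \<Delta> i j 3 5 1 - \<Delta> i j 3 2 4 + \<Delta> i j 3 1 5
      + \<Delta> i j 4 5 6 - \<Delta> i j 4 6 5 + \<Delta> i j 5 6 4
      - \<Delta> i j 5 4 6 + \<Delta> i j 6 4 5 - \<Delta> i j 6 5 4" for i j
    by (simp add: sum_6 struct_const_eq vector_6 cross3_def \<Delta>_def algebra_simps)
  then have "(\<Sum>i\<in>UNIV. \<Sum>j\<in>UNIV. \<Sum>k\<in>UNIV. struct_const i j k * lam k p * u i * w j) =
      lam 1 p * (u 5 * w 3) - lam 1 p * (u 6 * w 2)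
      - lam 1 p * (u 3 * w 5) + lam 1 p * (u 2 * w 6)
      + lam 2 p * (u 6 * w 1) - lam 2 p * (u 4 * w 3)
      - lam 2 p * (u 1 * w 6) + lam 2 p * (u 3 * w 4)
      + lam 3 p * (u 4 * w 2) - lam 3 p * (u 5 * w 1)
      - lam 3 p * (u 2 * w 4) + lam 3 p * (u 1 * w 5)
      + lam 4 p * (u 5 * w 6) - lam 4 p * (u 6 * w 5)
      + lam 5 p * (u 6 * w 4) - lam 5 p * (u 4 * w 6)
      + lam 6 p * (u 4 * w 5) - lam 6 p * (u 5 * w 4)"
    by (simp only: sum.distrib sum_subtractf \<Delta>_sum)
  then show ?thesis
    unfolding poisson_def u_def w_def by (simp add: algebra_simps)
qed

lemma poisson_antisym: "poisson F G p = - poisson G F p"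
  unfolding poisson_eq by (simp add: sum_6 algebra_simps)

lemma poisson_self: "poisson F F p = 0"
  using poisson_antisym[of F F p] by simp

section \<open>Derivatives of the integrals\<close>

lemma bounded_linear_lam: "bounded_linear (lam i)"
  unfolding lam_def by (intro bounded_linear_compose[OF bounded_linear_vec_nth] bounded_linear_snd)

lemma bounded_linear_entry: "bounded_linear (\<lambda>p :: phase. snd (fst p) $ i $ j)"
  by (intro bounded_linear_compose[OF bounded_linear_vec_nth]
      bounded_linear_compose[OF bounded_linear_snd] bounded_linear_fst)

text \<open>As a polynomial in matrix entries and momenta, \<open>rho i\<close> is accessible to the
  derivative and smoothness rules for linear coordinates.\<close>

lemma rho_eq:
  "rho i = (\<lambda>p. - (snd (fst p) $ i $ 1 * lam 1 p + snd (fst p) $ i $ 2 * lam 2 p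
                 + snd (fst p) $ i $ 3 * lam 3 p))"
  by (auto simp: fun_eq_iff rho_def matrix_vector_mult_def sum_3)

lemmas has_derivative_lam [derivative_intros] =
  bounded_linear.has_derivative[OF bounded_linear_lam]
lemmas has_derivative_entry [derivative_intros] =
  bounded_linear.has_derivative[OF bounded_linear_entry]

lemma frechet_derivative_rho:
  "frechet_derivative (rho i) (at p) v =
     - (snd (fst v) $ i $ 1 * lam 1 p + snd (fst v) $ i $ 2 * lam 2 p + snd (fst v) $ i $ 3 * lam 3 p)
     - (snd (fst p) $ i $ 1 * lam 1 v + snd (fst p) $ i $ 2 * lam 2 v + snd (fst p) $ i $ 3 * lam 3 v)"
proof -
  have "(rho i has_derivative (\<lambda>v.
     - (snd (fst v) $ i $ 1 * lam 1 p + snd (fst v) $ i $ 2 * lam 2 p + snd (fst v) $ i $ 3 * lam 3 p)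
     - (snd (fst p) $ i $ 1 * lam 1 v + snd (fst p) $ i $ 2 * lam 2 v + snd (fst p) $ i $ 3 * lam 3 v)))
     (at p)"
    unfolding rho_eq
    by (auto intro!: derivative_eq_intros simp: fun_eq_iff algebra_simps)
  then show ?thesis by (simp add: frechet_derivative_at [symmetric])
qed

lemma frechet_derivative_Wint:
  "frechet_derivative Wint (at p) v =
     - (lam 1 v * lam 4 p + lam 1 p * lam 4 v + lam 2 v * lam 5 p + lam 2 p * lam 5 v
        + lam 3 v * lam 6 p + lam 3 p * lam 6 v)"
proof -
  have "(Wint has_derivative (\<lambda>v.
     - (lam 1 v * lam 4 p + lam 1 p * lam 4 v + lam 2 v * lam 5 p + lam 2 p * lam 5 v
        + lam 3 v * lam 6 p + lam 3 p * lam 6 v))) (at p)"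
    unfolding Wint_def [abs_def]
    by (auto intro!: derivative_eq_intros simp: fun_eq_iff algebra_simps)
  then show ?thesis by (simp add: frechet_derivative_at [symmetric])
qed

lemma frechet_derivative_Ham:
  "frechet_derivative Ham (at p) v = lam 3 p * lam 3 v + lam 4 p * lam 4 v + lam 5 p * lam 5 v"
proof -
  have "(Ham has_derivative
      (\<lambda>v. lam 3 p * lam 3 v + lam 4 p * lam 4 v + lam 5 p * lam 5 v)) (at p)"
    unfolding Ham_def [abs_def]
    by (auto intro!: derivative_eq_intros simp: fun_eq_iff algebra_simps)
  then show ?thesis by (simp add: frechet_derivative_at [symmetric])
qed

lemmas frechet_derivative_integrals =
  frechet_derivative_rho frechet_derivative_Wint frechet_derivative_Ham frechet_derivative_lam

lemma lam_axis: "lam i (c, axis j 1) = (if i = j then 1 else 0)"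
  by (simp add: lam_def axis_def)

lemma lam_zero: "lam i (c, 0) = 0"
  by (simp add: lam_def)

lemma horizontal_deriv_integrals:
  "horizontal_deriv i Wint p = 0" "horizontal_deriv i Ham p = 0" "horizontal_deriv i (lam j) p = 0"
  by (simp_all add: horizontal_deriv_def frechet_derivative_integrals lam_zero)

text \<open>Let r be row k of the rotation and m = (\<open>lam 1\<close>, \<open>lam 2\<close>,
  \<open>lam 3\<close>). The vertical derivatives are (-r, 0). The position does not enter, and
  along the rotational fields the derivative is -r . (e_i x m), which is component i of r x
  m.\<close>

lemma partial_deriv_rho:
  "vertical_deriv 1 (rho k) p = - snd (fst p) $ k $ 1"
  "vertical_deriv 2 (rho k) p = - snd (fst p) $ k $ 2"
  "vertical_deriv 3 (rho k) p = - snd (fst p) $ k $ 3"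
  "vertical_deriv 4 (rho k) p = 0"
  "vertical_deriv 5 (rho k) p = 0"
  "vertical_deriv 6 (rho k) p = 0"
  "horizontal_deriv 1 (rho k) p = 0"
  "horizontal_deriv 2 (rho k) p = 0"
  "horizontal_deriv 3 (rho k) p = 0"
  "horizontal_deriv 4 (rho k) p = snd (fst p) $ k $ 2 * lam 3 p - snd (fst p) $ k $ 3 * lam 2 p"
  "horizontal_deriv 5 (rho k) p = snd (fst p) $ k $ 3 * lam 1 p - snd (fst p) $ k $ 1 * lam 3 p"
  "horizontal_deriv 6 (rho k) p = snd (fst p) $ k $ 1 * lam 2 p - snd (fst p) $ k $ 2 * lam 1 p"
proof -
  note D = vertical_deriv_def horizontal_deriv_def frechet_derivative_rho
  show "vertical_deriv 1 (rho k) p = - snd (fst p) $ k $ 1"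
    "vertical_deriv 2 (rho k) p = - snd (fst p) $ k $ 2"
    "vertical_deriv 3 (rho k) p = - snd (fst p) $ k $ 3"
    "vertical_deriv 4 (rho k) p = 0" "vertical_deriv 5 (rho k) p = 0" "vertical_deriv 6 (rho k) p = 0"
    by (simp_all add: D lam_axis)
  show "horizontal_deriv 1 (rho k) p = 0" "horizontal_deriv 2 (rho k) p = 0"
    "horizontal_deriv 3 (rho k) p = 0"
    "horizontal_deriv 4 (rho k) p = snd (fst p) $ k $ 2 * lam 3 p - snd (fst p) $ k $ 3 * lam 2 p"
    "horizontal_deriv 5 (rho k) p = snd (fst p) $ k $ 3 * lam 1 p - snd (fst p) $ k $ 1 * lam 3 p"
    "horizontal_deriv 6 (rho k) p = snd (fst p) $ k $ 1 * lam 2 p - snd (fst p) $ k $ 2 * lam 1 p"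
    by (simp_all add: D frame_simps lam_zero sigma_def matrix_def cross3_def axis_def
        matrix_matrix_mult_def sum_3)
qed

lemma integrals_simps:
  "integrals 1 = rho 1" "integrals 2 = rho 2" "integrals 3 = rho 3"
  "integrals 4 = Wint" "integrals 5 = Ham" "integrals 6 = lam 6"
  by (simp_all add: integrals_def vector_6 fun_eq_iff)

lemma smooth_integrals: "smooth (integrals i)"
proof -
  note intros = smooth_diff smooth_uminus smooth_add smooth_mult smooth_const smooth_power2
    smooth_linear[OF bounded_linear_lam] smooth_linear[OF bounded_linear_entry]
  have "smooth (rho j)" for j
    unfolding rho_eq by (intro intros)
  moreover have "smooth Wint"
    unfolding Wint_def [abs_def] by (intro intros)
  moreover have "smooth Ham"
    unfolding Ham_def [abs_def] by (intro intros)
  ultimately show ?thesis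
    using exhaust_6[of i] by (auto simp: integrals_simps smooth_linear[OF bounded_linear_lam])
qed

section \<open>Involution\<close>

text \<open>With r, m as above and w the rotational vertical derivatives of \<open>G\<close>, the
  canonical part gives -(r x m) . w and the Lie-Poisson part gives m . (w x r); these
  cancel.\<close>

lemma poisson_rho_momenta:
  assumes "\<And>i. horizontal_deriv i G p = 0"
  shows "poisson (rho k) G p = 0"
  unfolding poisson_eq assms
  by (simp add: sum_6 partial_deriv_rho algebra_simps)

text \<open>Vertical derivatives live in directions 1 to 3 and horizontal ones in directions 4 to 6,
  so the canonical part vanishes; every Lie-Poisson term needs a vertical derivative in a direction
  from 4 to 6.\<close>

lemma poisson_rho_rho: "poisson (rho i) (rho j) p = 0"
  unfolding poisson_eq
  by (simp add: sum_6 partial_deriv_rho)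

text \<open>The gradient of \<open>Wint\<close> swaps linear and angular momentum up to sign, so the
  Lie-Poisson terms are triple products that vanish by a repeated factor or cancel by cyclic
  symmetry.\<close>

lemma poisson_Wint_momenta:
  assumes "\<And>i. horizontal_deriv i G p = 0"
  shows "poisson Wint G p = 0"
  unfolding poisson_eq assms horizontal_deriv_integrals
  by (simp add: vertical_deriv_def[of _ Wint] frechet_derivative_Wint lam_axis algebra_simps)

text \<open>On the momenta, \<open>lam 6\<close> generates the simultaneous rotation of the pairs
  (\<open>lam 1\<close>, \<open>lam 2\<close>) and (\<open>lam 4\<close>, \<open>lam 5\<close>),
  which preserves \<open>Ham\<close>.\<close>

lemma poisson_Ham_lam6: "poisson Ham (lam 6) p = 0"
  unfolding poisson_eq horizontal_deriv_integrals
  by (simp add: vertical_deriv_def frechet_derivative_integrals lam_axis algebra_simps)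

lemma poisson_integrals: "poisson (integrals i) (integrals j) p = 0"
proof -
  note mom = horizontal_deriv_integrals
  have swap: "poisson F G p = 0" if "poisson G F p = 0" for F G
    using that poisson_antisym[of F G p] by simp
  have rho: "poisson (rho k) (integrals j) p = 0" for k j
    using exhaust_6[of j]
    by (elim disjE; simp only: integrals_simps poisson_rho_rho poisson_rho_momenta[OF mom(1)]
        poisson_rho_momenta[OF mom(2)] poisson_rho_momenta[OF mom(3)])
  have Wint: "poisson Wint (integrals j) p = 0" for j
    using exhaust_6[of j]
    by (elim disjE; simp only: integrals_simps poisson_Wint_momenta[OF mom(1)]
        poisson_Wint_momenta[OF mom(2)] poisson_Wint_momenta[OF mom(3)]
        swap[OF rho[of _ 4, unfolded integrals_simps]])
  have "poisson Ham (integrals j) p = 0" for j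
    using exhaust_6[of j]
    by (elim disjE; simp only: integrals_simps poisson_Ham_lam6 poisson_self
        swap[OF rho[of _ 5, unfolded integrals_simps]] swap[OF Wint[of 5, unfolded integrals_simps]])
  moreover have "poisson (lam 6) (integrals j) p = 0" for j
    using exhaust_6[of j]
    by (elim disjE; simp only: integrals_simps poisson_self swap[OF poisson_Ham_lam6]
        swap[OF rho[of _ 6, unfolded integrals_simps]] swap[OF Wint[of 6, unfolded integrals_simps]])
  ultimately show ?thesis
    using exhaust_6[of i] rho Wint by (elim disjE; simp only: integrals_simps)
qed

lemma in_involution_integrals: "in_involution integrals"
  by (simp add: in_involution_def poisson_integrals)

section \<open>The Hamiltonian field and its first integrals\<close>

lemma system_field_tangent: "system_field p \<in> tangent_phase p"
  unfolding tangent_phase_def system_field_def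
  by (simp add: span_add span_scale span_base)

text \<open>Expanding the field in the frame and the momentum axes turns its action on
  \<open>F\<close> into horizontal and vertical derivatives. They match the bracket because the
  gradient of \<open>Ham\<close> is \<open>lam i\<close> in the momentum directions i = 3, 4, 5 and
  zero elsewhere.\<close>

lemma hamiltonian_field_system: "hamiltonian_field Ham system_field"
proof -
  have "frechet_derivative F (at p) (system_field p) = poisson Ham F p" if "smooth F" for F p
  proof -
    let ?D = "frechet_derivative F (at p)"
    interpret D: linear ?D
      using smooth_has_derivative[OF that] has_derivative_linear by blast
    have "system_field p = lam 3 p *\<^sub>R (frame 3 (fst p), 0) + lam 4 p *\<^sub>R (frame 4 (fst p), 0)
        + lam 5 p *\<^sub>R (frame 5 (fst p), 0)
        + (- lam 3 p * lam 5 p) *\<^sub>R (0, axis 1 1) + (lam 3 p * lam 4 p) *\<^sub>R (0, axis 2 1)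
        + (lam 1 p * lam 5 p - lam 2 p * lam 4 p) *\<^sub>R (0, axis 3 1)
        + (lam 2 p * lam 3 p - lam 5 p * lam 6 p) *\<^sub>R (0, axis 4 1)
        + (lam 4 p * lam 6 p - lam 1 p * lam 3 p) *\<^sub>R (0, axis 5 1)"
      unfolding system_field_def
      by (simp add: vec_eq_iff forall_6 vector_6 axis_def)
    then have "?D (system_field p) =
        lam 3 p * horizontal_deriv 3 F p + lam 4 p * horizontal_deriv 4 F p
        + lam 5 p * horizontal_deriv 5 F p
        + (- lam 3 p * lam 5 p) * vertical_deriv 1 F p + (lam 3 p * lam 4 p) * vertical_deriv 2 F p
        + (lam 1 p * lam 5 p - lam 2 p * lam 4 p) * vertical_deriv 3 F p
        + (lam 2 p * lam 3 p - lam 5 p * lam 6 p) * vertical_deriv 4 F p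
        + (lam 4 p * lam 6 p - lam 1 p * lam 3 p) * vertical_deriv 5 F p"
      by (simp only: D.add D.scale horizontal_deriv_def vertical_deriv_def real_scaleR_def)
    also have "\<dots> = poisson Ham F p"
      unfolding poisson_eq horizontal_deriv_integrals
      by (simp add: sum_6 vertical_deriv_def[of _ Ham] frechet_derivative_Ham lam_axis algebra_simps)
    finally show ?thesis .
  qed
  then show ?thesis
    by (simp add: hamiltonian_field_def system_field_tangent)
qed

text \<open>By the chain rule the derivative of \<open>F\<close> along a solution is the bracket
  with \<open>H\<close>, hence zero; a function with zero derivative on an interval is
  constant.\<close>

lemma first_integral_if_commutes:
  assumes "hamiltonian_field H X" "smooth F" "\<And>p. p \<in> cotangent_SE3 \<Longrightarrow> poisson H F p = 0"
  shows "first_integral X F"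
  unfolding first_integral_def
proof (intro conjI allI impI ballI)
  fix I z s t
  assume sol: "solution X I z" and "s \<in> I" "t \<in> I"
  have "((\<lambda>t. F (z t)) has_derivative (\<lambda>h. 0)) (at t within I)" if "t \<in> I" for t
  proof -
    let ?D = "frechet_derivative F (at (z t))"
    have z: "z t \<in> cotangent_SE3" "(z has_derivative (\<lambda>h. h *\<^sub>R X (z t))) (at t within I)"
      using sol that by (auto simp: solution_def has_vector_derivative_def)
    have "?D (X (z t)) = 0"
      using assms z(1) by (simp add: hamiltonian_field_def)
    then have "?D (h *\<^sub>R X (z t)) = 0" for h
      using linear_cmul[OF has_derivative_linear[OF smooth_has_derivative[OF assms(2)]]] by simp
    then show ?thesis
      using has_derivative_compose[OF z(2) smooth_has_derivative[OF assms(2)]] by simp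
  qed
  moreover have "convex I"
    using sol by (simp add: solution_def is_interval_convex)
  ultimately obtain c where "\<And>t. t \<in> I \<Longrightarrow> F (z t) = c"
    using has_derivative_zero_constant[of I "\<lambda>t. F (z t)"] by blast
  with \<open>s \<in> I\<close> \<open>t \<in> I\<close> show "F (z s) = F (z t)"
    by simp
qed (fact assms(2))

lemma first_integral_integrals: "first_integral system_field (integrals i)"
  \<comment> \<open>Index 5 is \<open>Ham\<close>, so involution of the family already contains
    commutation with the Hamiltonian.\<close>
  using poisson_integrals[of 5 i]
  by (intro first_integral_if_commutes[OF hamiltonian_field_system smooth_integrals])
     (simp add: integrals_simps)

section \<open>Functional independence\<close>

lemma functionally_independent_at_integrals:
  assumes "p \<in> cotangent_SE3" and nz: "lam 1 p * lam 5 p - lam 2 p * lam 4 p \<noteq> 0"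
  shows "functionally_independent_at integrals p"
  unfolding functionally_independent_at_def
proof (intro allI impI)
  fix c :: "6 \<Rightarrow> real" and i
  assume c: "\<forall>v\<in>tangent_phase p. (\<Sum>i\<in>UNIV. c i * frechet_derivative (integrals i) (at p) v) = 0"
  let ?R = "snd (fst p)"
  let ?c = "vector [c 1, c 2, c 3] :: real^3"
  have "(0, axis m 1) \<in> tangent_phase p" for m
    by (simp add: tangent_phase_def span_zero)
  then have "(\<Sum>i\<in>UNIV. c i * frechet_derivative (integrals i) (at p) (0, axis m 1)) = 0" for m
    using c by blast
  note D = this[unfolded sum_6 integrals_simps frechet_derivative_integrals lam_axis]
  have 4: "- c 4 * lam 1 p + c 5 * lam 4 p = 0" and 5: "- c 4 * lam 2 p + c 5 * lam 5 p = 0"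
    and 6: "- c 4 * lam 3 p + c 6 = 0"
    using D[of 4] D[of 5] D[of 6] by simp_all
  \<comment> \<open>Cramer's rule: up to sign the factor is the determinant of the 2x2 system
    \<open>4\<close>, \<open>5\<close> for \<open>c 4\<close> and \<open>c 5\<close>.\<close>
  have "c 4 * (lam 1 p * lam 5 p - lam 2 p * lam 4 p) = 0"
    "c 5 * (lam 1 p * lam 5 p - lam 2 p * lam 4 p) = 0"
    using 4 5 by algebra+
  with nz have c45: "c 4 = 0" "c 5 = 0"
    by simp_all
  with 6 have c6: "c 6 = 0"
    by simp
  \<comment> \<open>Momentum direction j sees column j of the rotation, hence the transpose.\<close>
  have "transpose ?R *v ?c = 0"
    using D[of 1] D[of 2] D[of 3] c45 c6
    by (simp add: vec_eq_iff forall_3 sum_3 transpose_def matrix_vector_mult_def algebra_simps)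
  moreover have "?R ** transpose ?R = mat 1"
    using assms(1)
    by (auto simp: cotangent_SE3_def SE3_def rotation_matrix_def orthogonal_matrix_def)
  ultimately have "?c = 0"
    using matrix_vector_mul_assoc[of ?R "transpose ?R" ?c] by simp
  then have "c 1 = 0" "c 2 = 0" "c 3 = 0"
    by (simp_all add: vec_eq_iff forall_3)
  with c45 c6 show "c i = 0"
    using exhaust_6[of i] by auto
qed

lemma functionally_independent_integrals: "functionally_independent integrals"
proof -
  let ?d = "\<lambda>p. lam 1 p * lam 5 p - lam 2 p * lam 4 p"
  let ?U = "{p \<in> cotangent_SE3. ?d p \<noteq> 0}"
  have "open {p. ?d p \<noteq> 0}"
    by (intro open_Collect_neq continuous_intros linear_continuous_on bounded_linear_lam)
  then have "openin (top_of_set cotangent_SE3) ?U"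
    by (auto simp: openin_open)
  moreover have "cotangent_SE3 \<subseteq> closure ?U"
  proof
    fix p
    assume p: "p \<in> cotangent_SE3"
    \<comment> \<open>Shifting \<open>lam 1\<close> and \<open>lam 5\<close> together by t
      contributes t^2 to \<open>?d\<close>, whatever \<open>p\<close> is. Only the momenta move, so
      the curve stays in the cotangent bundle.\<close>
    define l :: "real \<Rightarrow> real^6" where
      "l t = snd p + t *\<^sub>R vector [1, 0, 0, 0, 1, 0]" for t
    have d: "?d (fst p, l t) = ?d p + t * (lam 1 p + lam 5 p) + t\<^sup>2" for t
      by (simp add: l_def lam_def vector_6 algebra_simps power2_eq_square)
    text \<open>As a monic quadratic in \<open>t\<close>, \<open>?d (fst p, l t)\<close> is nonzero for all small \<open>t \<noteq> 0\<close>.\<close>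
    have "eventually (\<lambda>t. ?d (fst p, l t) \<noteq> 0) (at 0)"
    proof -
      have "finite {t. poly [:?d p, lam 1 p + lam 5 p, 1:] t = 0}"
        by (rule poly_roots_finite) simp
      then have "finite {t. ?d (fst p, l t) = 0}"
        unfolding d by (simp add: algebra_simps power2_eq_square)
      from islimpt_finite[OF this, of 0] show ?thesis
        by (simp add: islimpt_iff_eventually)
    qed
    moreover have "((\<lambda>t. (fst p, l t)) \<longlongrightarrow> (fst p, l 0)) (at 0)"
      unfolding l_def by (intro tendsto_intros)
    moreover have "(fst p, l t) \<in> cotangent_SE3" for t
      using p by (auto simp: cotangent_SE3_def)
    ultimately have "eventually (\<lambda>t. (fst p, l t) \<in> closure ?U) (at 0)"
        "((\<lambda>t. (fst p, l t)) \<longlongrightarrow> p) (at 0)"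
      by (auto elim!: eventually_mono simp: l_def intro: subsetD[OF closure_subset])
    then show "p \<in> closure ?U"
      by (intro Lim_in_closed_set[OF closed_closure _ trivial_limit_at])
  qed
  ultimately show ?thesis
    unfolding functionally_independent_def
    using functionally_independent_at_integrals by blast
qed

section \<open>Angle formulas for the integrals and the assembled theorem\<close>

lemma rho_angles:
  fixes x :: "real^3" and l :: "real^6" and \<alpha> \<beta> \<gamma> :: real
  defines "p \<equiv> ((x, rot_x \<gamma> ** rot_y \<beta> ** rot_z \<alpha>), l)"
  shows "rho 1 p = - (l$1) * cos \<alpha> * cos \<beta> + l$2 * cos \<beta> * sin \<alpha> - l$3 * sin \<beta>"
    and "rho 2 p = - cos \<gamma> * (l$2 * cos \<alpha> + l$1 * sin \<alpha>)
                    + (l$3 * cos \<beta> + (- (l$1) * cos \<alpha> + l$2 * sin \<alpha>) * sin \<beta>) * sin \<gamma>"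
    and "rho 3 p = - (l$3) * cos \<beta> * cos \<gamma> + cos \<gamma> * (l$1 * cos \<alpha> - l$2 * sin \<alpha>) * sin \<beta>
                    - (l$2 * cos \<alpha> + l$1 * sin \<alpha>) * sin \<gamma>"
  by (simp_all add: p_def rho_eq lam_def rot_x_def rot_y_def rot_z_def
      matrix_matrix_mult_def sum_3 algebra_simps)

lemma liouville_integrable_system: "liouville_integrable system_field"
  unfolding liouville_integrable_def
  using first_integral_integrals in_involution_integrals functionally_independent_integrals by blast

theorem theorem2:
  shows "hamiltonian_field Ham system_field
    \<and> liouville_integrable system_field
    \<and> (\<forall>i. first_integral system_field (integrals i))
    \<and> in_involution integrals
    \<and> functionally_independent integrals
    \<and> (\<forall>(x :: real^3) (l :: real^6) \<alpha> \<beta> \<gamma>.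
        let p = ((x, rot_x \<gamma> ** rot_y \<beta> ** rot_z \<alpha>), l) in
          rho 1 p = - (l$1) * cos \<alpha> * cos \<beta> + l$2 * cos \<beta> * sin \<alpha> - l$3 * sin \<beta>
        \<and> rho 2 p = - cos \<gamma> * (l$2 * cos \<alpha> + l$1 * sin \<alpha>)
                    + (l$3 * cos \<beta> + (- (l$1) * cos \<alpha> + l$2 * sin \<alpha>) * sin \<beta>) * sin \<gamma>
        \<and> rho 3 p = - (l$3) * cos \<beta> * cos \<gamma> + cos \<gamma> * (l$1 * cos \<alpha> - l$2 * sin \<alpha>) * sin \<beta>
                    - (l$2 * cos \<alpha> + l$1 * sin \<alpha>) * sin \<gamma>)"
  by (simp add: Let_def rho_angles hamiltonian_field_system first_integral_integrals
      in_involution_integrals functionally_independent_integrals liouville_integrable_system)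

end
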